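(* Suppose a graph $G$ has a convex compact visibility representation in which two sightlines $\overline{ab}$ and $\overline{vw}$ intersect, where $a,b,v,w$ lie in four distinct regions $A,B,V,W$ respectively. Then the vertices $A$ and $B$ lie in a common subgraph of $G$ isomorphic to $K_4$.
   Context: All graphs are finite and simple. Given a family of pairwise disjoint nonempty connected subsets ("regions") of $\mathbb{R}^2$, a sightline is a closed line segment $\overline{ab}$ with $a\in A$, $b\in B$ for two different regions $A\neq B$ of the family, such that the segment intersects no region of the family other than $A$ and $B$. A visibility representation of $G$ is such a family with one region per vertex, such that two distinct vertices are adjacent in $G$ if and only if there is a sightline between their regions; it is convex compact if every region is compact and convex. Vertices are identified with their regions. *)

theory Defs
  imports "HOL-Analysis.Analysis"
begin

definition simple_graph :: "'v set \<Rightarrow> ('v \<Rightarrow> 'v \<Rightarrow> bool) \<Rightarrow> bool" where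
  "simple_graph Vs E \<longleftrightarrow> finite Vs \<and> (\<forall>x y. E x y \<longrightarrow> E y x) \<and> (\<forall>x. \<not> E x x)
     \<and> (\<forall>x y. E x y \<longrightarrow> x \<in> Vs \<and> y \<in> Vs)"

definition region_family :: "'v set \<Rightarrow> ('v \<Rightarrow> (real^2) set) \<Rightarrow> bool" where
  "region_family Vs R \<longleftrightarrow>
     (\<forall>x\<in>Vs. R x \<noteq> {} \<and> connected (R x)) \<and>
     (\<forall>x\<in>Vs. \<forall>y\<in>Vs. x \<noteq> y \<longrightarrow> R x \<inter> R y = {})"

definition is_sightline :: "'v set \<Rightarrow> ('v \<Rightarrow> (real^2) set) \<Rightarrow> 'v \<Rightarrow> 'v \<Rightarrow> real^2 \<Rightarrow> real^2 \<Rightarrow> bool" where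
  "is_sightline Vs R x y a b \<longleftrightarrow> x \<in> Vs \<and> y \<in> Vs \<and> x \<noteq> y \<and> a \<in> R x \<and> b \<in> R y \<and>
     (\<forall>z\<in>Vs. z \<noteq> x \<and> z \<noteq> y \<longrightarrow> closed_segment a b \<inter> R z = {})"

definition visibility_rep :: "'v set \<Rightarrow> ('v \<Rightarrow> 'v \<Rightarrow> bool) \<Rightarrow> ('v \<Rightarrow> (real^2) set) \<Rightarrow> bool" where
  "visibility_rep Vs E R \<longleftrightarrow> region_family Vs R \<and>
     (\<forall>x\<in>Vs. \<forall>y\<in>Vs. x \<noteq> y \<longrightarrow> (E x y \<longleftrightarrow> (\<exists>a b. is_sightline Vs R x y a b)))"

definition convex_compact_visibility_rep :: "'v set \<Rightarrow> ('v \<Rightarrow> 'v \<Rightarrow> bool) \<Rightarrow> ('v \<Rightarrow> (real^2) set) \<Rightarrow> bool" where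
  "convex_compact_visibility_rep Vs E R \<longleftrightarrow> visibility_rep Vs E R \<and>
     (\<forall>x\<in>Vs. compact (R x) \<and> convex (R x))"

end

theory Submission
  imports Defs
begin

text \<open>
  Among all sightlines \<open>ab\<close> between \<open>A\<close> and \<open>B\<close> crossing the fixed segment \<open>vw\<close>, take one that
  minimises the sum of the distances of its ends from \<open>vw\<close> up to a small \<open>\<epsilon>\<close>. (An exact minimiser need
  not exist: limits of sightlines may touch further regions.) Grow from \<open>ab\<close> a kite with
  vertices \<open>a\<close>, \<open>b\<close> and two vertices on \<open>vw\<close>, on each side of \<open>ab\<close> until a region other than \<open>A\<close>, \<open>B\<close> is
  touched; the contact points \<open>c\<close> and \<open>d\<close> lie in the sought regions \<open>C\<close> and \<open>D\<close>. The interior of the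
  kite meets only \<open>A\<close> and \<open>B\<close>, so only these can obstruct \<open>cd\<close>, \<open>ca\<close> or \<open>cb\<close>. But a point of \<open>A\<close> on
  such a segment would be nearer to \<open>vw\<close> than \<open>a\<close> by at least \<open>\<epsilon>\<close>, and would see \<open>b\<close> across \<open>vw\<close>.
\<close>

section \<open>Piecewise linear gauges on the line\<close>

text \<open>For positive \<alpha> and \<beta> this is the Minkowski gauge of the interval from
  \<open>- \<beta>\<close> to \<alpha>: an absolute value with separate slopes on the two sides of
  its kink at 0.\<close>

definition tent :: "real \<Rightarrow> real \<Rightarrow> real \<Rightarrow> real" where
  "tent \<alpha> \<beta> u = max (u / \<alpha>) (- (u / \<beta>))"

lemma tent_uminus: "tent \<alpha> \<beta> (- u) = tent \<beta> \<alpha> u"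
  by (simp add: tent_def max.commute)

lemma tent_nonneg: "0 < \<alpha> \<Longrightarrow> 0 < \<beta> \<Longrightarrow> 0 \<le> tent \<alpha> \<beta> u"
  by (cases "0 \<le> u") (auto simp: tent_def le_max_iff_disj divide_nonpos_pos)

lemma tent_eq_pos: "0 < \<alpha> \<Longrightarrow> 0 < \<beta> \<Longrightarrow> 0 \<le> u \<Longrightarrow> tent \<alpha> \<beta> u = u / \<alpha>"
  unfolding tent_def by (rule max_absorb1) (smt (verit) divide_nonneg_pos divide_nonpos_pos)

lemma tent_eq_neg: "0 < \<alpha> \<Longrightarrow> 0 < \<beta> \<Longrightarrow> u \<le> 0 \<Longrightarrow> tent \<alpha> \<beta> u = - u / \<beta>"
  using tent_eq_pos[of \<beta> \<alpha> "- u"] by (simp add: tent_uminus)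

lemma tent_le_one:
  assumes "0 < \<alpha>" "0 < \<beta>" "tent \<alpha> \<beta> u \<le> 1"
  shows "u \<le> \<alpha>" "- \<beta> \<le> u"
proof -
  have "u / \<alpha> \<le> 1" "(- u) / \<beta> \<le> 1" using assms(3) by (auto simp: tent_def)
  then show "u \<le> \<alpha>" "- \<beta> \<le> u" using assms(1,2) by (auto simp only: divide_le_eq_1_pos)
qed

lemma tent_scale: "0 \<le> m \<Longrightarrow> tent \<alpha> \<beta> (m * u) = m * tent \<alpha> \<beta> u"
  unfolding tent_def by (simp add: max_mult_distrib_left)

lemma tent_convex:
  assumes "0 \<le> l" "l \<le> 1"
  shows "tent \<alpha> \<beta> ((1 - l) * u + l * v) \<le> (1 - l) * tent \<alpha> \<beta> u + l * tent \<alpha> \<beta> v"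
proof -
  have "(1 - l) * (u / \<alpha>) + l * (v / \<alpha>) \<le> (1 - l) * tent \<alpha> \<beta> u + l * tent \<alpha> \<beta> v"
       "(1 - l) * - (u / \<beta>) + l * - (v / \<beta>) \<le> (1 - l) * tent \<alpha> \<beta> u + l * tent \<alpha> \<beta> v"
    using assms unfolding tent_def by (intro add_mono mult_left_mono; simp)+
  then show ?thesis
    by (subst tent_def) (simp add: add_divide_distrib)
qed

text \<open>Each of the two linear pieces falls strictly below \<open>tent\<close> at one of
  \<open>u\<close>, \<open>v\<close>, since these have opposite signs. That end has positive weight,
  so both pieces stay strictly below the chord, and so does their maximum.\<close>

lemma tent_strictly_convex:
  assumes l: "0 < l" "l < 1" and p: "0 < \<alpha>" "0 < \<beta>" and uv: "u * v < 0"
  shows "tent \<alpha> \<beta> ((1 - l) * u + l * v) < (1 - l) * tent \<alpha> \<beta> u + l * tent \<alpha> \<beta> v"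
proof -
  have pos: "- (x / \<beta>) < tent \<alpha> \<beta> x" if "0 < x" for x
    using that p by (simp add: tent_def less_max_iff_disj) (meson divide_pos_pos less_trans neg_less_0_iff_less)
  have neg: "x / \<alpha> < tent \<alpha> \<beta> x" if "x < 0" for x
    using that p by (simp add: tent_def less_max_iff_disj) (smt (verit) divide_neg_pos)
  have le: "x / \<alpha> \<le> tent \<alpha> \<beta> x" "- (x / \<beta>) \<le> tent \<alpha> \<beta> x" for x
    by (auto simp: tent_def)
  have *: "(1 - l) * x + l * y < (1 - l) * x' + l * y'" 
    if "x \<le> x'" "y \<le> y'" "x < x' \<or> y < y'" for x x' y y'
    using that l by (auto intro: add_less_le_mono add_le_less_mono)
  have "u < 0 \<and> 0 < v \<or> 0 < u \<and> v < 0" using uv by (auto simp: mult_less_0_iff)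
  then have "(1 - l) * (u / \<alpha>) + l * (v / \<alpha>) < (1 - l) * tent \<alpha> \<beta> u + l * tent \<alpha> \<beta> v"
       "(1 - l) * - (u / \<beta>) + l * - (v / \<beta>) < (1 - l) * tent \<alpha> \<beta> u + l * tent \<alpha> \<beta> v"
    using pos neg by (intro *; auto intro: le)+
  then show ?thesis
    by (subst tent_def) (simp add: add_divide_distrib)
qed

lemma continuous_on_tent [continuous_intros]:
  "continuous_on S f \<Longrightarrow> continuous_on S (\<lambda>x. tent \<alpha> \<beta> (f x))"
  unfolding tent_def by (cases "\<alpha> = 0"; cases "\<beta> = 0") (auto intro!: continuous_intros)

section \<open>First contact of a growing triangle with a compact set\<close>

text \<open>
  The sign conditions on \<open>fst c\<close> make both ends of the base visible from \<open>c\<close>: an end on the other side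
  is seen through the interior, an end on the same side along an edge on which \<open>c\<close> is the contact
  nearest to it.
\<close>

lemma first_contact:
  fixes G :: "(real \<times> real) set"
  assumes G: "compact G" "(0, 1) \<in> G" and p: "0 < \<alpha>" "0 < \<beta>"
    and base: "\<And>x. (x, 0) \<in> G \<Longrightarrow> 1 < tent \<alpha> \<beta> x"
  obtains \<tau> c where "0 < \<tau>" "\<tau> \<le> 1" "c \<in> G" "0 < snd c" "tent \<alpha> \<beta> (fst c) + snd c / \<tau> \<le> 1"
    "\<And>x. x \<in> G \<Longrightarrow> 0 \<le> snd x \<Longrightarrow> 1 \<le> tent \<alpha> \<beta> (fst x) + snd x / \<tau>"
    "0 < fst c \<or> (\<forall>x\<in>G. 0 \<le> snd x \<longrightarrow> tent \<alpha> \<beta> (fst x) + snd x / \<tau> \<le> 1 \<longrightarrow> fst c \<le> fst x)"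
    "fst c < 0 \<or> (\<forall>x\<in>G. 0 \<le> snd x \<longrightarrow> tent \<alpha> \<beta> (fst x) + snd x / \<tau> \<le> 1 \<longrightarrow> fst x \<le> fst c)"
proof -
  have cl: "closed {x::real\<times>real. 0 \<le> snd x \<and> tent \<alpha> \<beta> (fst x) + snd x / k \<le> 1}" if "0 < k" for k
    using that by (intro closed_Collect_conj closed_Collect_le continuous_intros) auto
  define K where "K = G \<inter> {x. 0 \<le> snd x \<and> tent \<alpha> \<beta> (fst x) + snd x / 1 \<le> 1}"
  have "compact K" unfolding K_def by (rule compact_Int_closed[OF G(1) cl]) simp
  have "(0, 1) \<in> K" using G by (simp add: K_def tent_def)
  have Kpos: "0 < snd x \<and> tent \<alpha> \<beta> (fst x) < 1" if "x \<in> K" for x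
  proof -
    have "snd x \<noteq> 0" using that base[of "fst x"] by (cases x) (auto simp: K_def)
    then show ?thesis using that by (auto simp: K_def)
  qed
  \<comment> \<open>\<open>h x\<close> is the height \<open>k\<close> for which \<open>x\<close>
    lies on the sides of the triangle
    \<open>tent \<alpha> \<beta> (fst x) + snd x / k \<le> 1\<close>. Its minimum over
    \<open>K\<close> is therefore the height of first contact.\<close>
  define h where "h x = snd x / (1 - tent \<alpha> \<beta> (fst x))" for x
  have "continuous_on K h" unfolding h_def
    using Kpos by (intro continuous_intros) force
  then obtain y where y: "y \<in> K" "\<And>x. x \<in> K \<Longrightarrow> h y \<le> h x"
    using continuous_attains_inf[OF \<open>compact K\<close>] \<open>(0,1) \<in> K\<close> by blast
  define \<tau> where "\<tau> = h y"
  have \<tau>0: "0 < \<tau>" using Kpos[OF y(1)] by (simp add: \<tau>_def h_def)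
  have \<tau>1: "\<tau> \<le> 1" using y(2)[OF \<open>(0,1) \<in> K\<close>] by (simp add: \<tau>_def h_def tent_def)
  define U where "U = G \<inter> {x. 0 \<le> snd x \<and> tent \<alpha> \<beta> (fst x) + snd x / \<tau> \<le> 1}"
  have "compact U" unfolding U_def by (rule compact_Int_closed[OF G(1) cl]) fact
  have "y \<in> U"
  proof -
    have "snd y / \<tau> = 1 - tent \<alpha> \<beta> (fst y)" using Kpos[OF y(1)] by (simp add: \<tau>_def h_def field_simps)
    then show ?thesis using y(1) by (simp add: U_def K_def)
  qed
  have UK: "x \<in> K" if "x \<in> U" for x
  proof -
    have "snd x \<le> snd x / \<tau>" using that \<tau>0 \<tau>1 by (simp add: U_def le_divide_eq mult_left_le)
    then show ?thesis using that by (auto simp: U_def K_def)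
  qed
  have ge: "1 \<le> tent \<alpha> \<beta> (fst x) + snd x / \<tau>" if x: "x \<in> G" "0 \<le> snd x" for x
  proof (rule ccontr)
    assume n: "\<not> ?thesis"
    then have "x \<in> U" using x by (simp add: U_def)
    then have K: "x \<in> K" by (rule UK)
    from y(2)[OF K] have "\<tau> \<le> snd x / (1 - tent \<alpha> \<beta> (fst x))" by (simp add: \<tau>_def h_def)
    then have "1 - tent \<alpha> \<beta> (fst x) \<le> snd x / \<tau>" using Kpos[OF K] \<tau>0 by (simp add: field_simps)
    with n show False by simp
  qed
  obtain c1 where c1: "c1 \<in> U" "\<And>x. x \<in> U \<Longrightarrow> fst x \<le> fst c1"
    using continuous_attains_sup[OF \<open>compact U\<close>, of fst] \<open>y \<in> U\<close> continuous_on_fst[OF continuous_on_id]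
    by blast
  obtain c2 where c2: "c2 \<in> U" "\<And>x. x \<in> U \<Longrightarrow> fst c2 \<le> fst x"
    using continuous_attains_inf[OF \<open>compact U\<close>, of fst] \<open>y \<in> U\<close> continuous_on_fst[OF continuous_on_id]
    by blast
  \<comment> \<open>If the rightmost contact \<open>c1\<close> has positive abscissa, it meets both
    side conditions. Otherwise all contacts have abscissa at most 0, and the leftmost one
    \<open>c2\<close> works: it is negative, or else every contact has abscissa 0.\<close>
  define c where "c = (if 0 < fst c1 then c1 else c2)"
  have c: "c \<in> U" using c1 c2 by (simp add: c_def)
  have lo: "0 < fst c \<or> (\<forall>x\<in>U. fst c \<le> fst x)" using c2 by (simp add: c_def)
  have hi: "fst c < 0 \<or> (\<forall>x\<in>U. fst x \<le> fst c)"
    using c1 c2(2)[OF c1(1)] c2 by (force simp: c_def)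
  show thesis
  proof (rule that[of \<tau> c])
    show "0 < snd c" using Kpos[OF UK[OF c]] by simp
    show "c \<in> G" "tent \<alpha> \<beta> (fst c) + snd c / \<tau> \<le> 1" using c by (simp_all add: U_def)
    show "0 < fst c \<or> (\<forall>x\<in>G. 0 \<le> snd x \<longrightarrow> tent \<alpha> \<beta> (fst x) + snd x / \<tau> \<le> 1 \<longrightarrow> fst c \<le> fst x)"
      using lo unfolding U_def by blast
    show "fst c < 0 \<or> (\<forall>x\<in>G. 0 \<le> snd x \<longrightarrow> tent \<alpha> \<beta> (fst x) + snd x / \<tau> \<le> 1 \<longrightarrow> fst x \<le> fst c)"
      using hi unfolding U_def by blast
    show "1 \<le> tent \<alpha> \<beta> (fst x) + snd x / \<tau>" if "x \<in> G" "0 \<le> snd x" for x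
      using that by (rule ge)
  qed (fact \<tau>0, fact \<tau>1)
qed

section \<open>Convexity of the distance function and oblique coordinates in the plane\<close>

text \<open>The same convex combination of almost nearest points of \<open>x\<close> and
  \<open>y\<close> lies in \<open>S\<close>. Working up to \<open>e\<close> avoids asking that
  nearest points exist.\<close>

lemma infdist_convex:
  fixes S :: "'a::real_normed_vector set"
  assumes "convex S" "S \<noteq> {}" "0 \<le> l" "l \<le> 1"
  shows "infdist ((1 - l) *\<^sub>R x + l *\<^sub>R y) S \<le> (1 - l) * infdist x S + l * infdist y S"
proof (rule field_le_epsilon)
  fix e :: real assume "0 < e"
  obtain m n where m: "m \<in> S" "dist x m < infdist x S + e" and n: "n \<in> S" "dist y n < infdist y S + e"
    using cINF_less_iff[of S "dist x" "infdist x S + e"] cINF_less_iff[of S "dist y" "infdist y S + e"]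
      assms(2) \<open>0 < e\<close> by (auto simp: infdist_notempty[symmetric])
  have "(1 - l) *\<^sub>R m + l *\<^sub>R n \<in> S" using assms m n by (simp add: convexD_alt)
  then have "infdist ((1 - l) *\<^sub>R x + l *\<^sub>R y) S \<le> dist ((1 - l) *\<^sub>R x + l *\<^sub>R y) ((1 - l) *\<^sub>R m + l *\<^sub>R n)"
    by (rule infdist_le)
  also have "\<dots> = norm ((1 - l) *\<^sub>R (x - m) + l *\<^sub>R (y - n))"
    by (simp add: dist_norm algebra_simps)
  also have "\<dots> \<le> (1 - l) * dist x m + l * dist y n"
    using assms by (intro order.trans[OF norm_triangle_ineq]) (simp add: dist_norm)
  also have "\<dots> \<le> (1 - l) * (infdist x S + e) + l * (infdist y S + e)"
    using assms m n by (intro add_mono mult_left_mono) auto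
  finally show "infdist ((1 - l) *\<^sub>R x + l *\<^sub>R y) S \<le> (1 - l) * infdist x S + l * infdist y S + e"
    by (simp add: algebra_simps)
qed

text \<open>Cramer's rule: \<open>D\<close> is the determinant of \<open>e\<close> and
  \<open>f\<close>, and the two functionals are quotients of determinants by
  \<open>D\<close>.\<close>

lemma coordinate_functionals:
  fixes e f :: "real^2"
  assumes "e \<noteq> 0" "\<And>k. f \<noteq> k *\<^sub>R e"
  obtains S T :: "real^2 \<Rightarrow> real" where "linear S" "linear T"
    "\<And>x. x = S x *\<^sub>R e + T x *\<^sub>R f" "S e = 1" "T e = 0" "S f = 0" "T f = 1"
proof -
  define D where "D = e$1 * f$2 - e$2 * f$1"
  have D: "D \<noteq> 0"
  proof
    assume 0: "D = 0"
    have "e$1 \<noteq> 0 \<or> e$2 \<noteq> 0" using assms(1) by (auto simp: vec_eq_iff forall_2)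
    then show False
    proof
      assume "e$1 \<noteq> 0"
      then have "f = (f$1 / e$1) *\<^sub>R e" using 0 by (auto simp: vec_eq_iff forall_2 D_def field_simps)
      then show False using assms(2) by blast
    next
      assume "e$2 \<noteq> 0"
      then have "f = (f$2 / e$2) *\<^sub>R e" using 0 by (auto simp: vec_eq_iff forall_2 D_def field_simps)
      then show False using assms(2) by blast
    qed
  qed
  show thesis
  proof (rule that[of "\<lambda>x. (x$1 * f$2 - x$2 * f$1) / D" "\<lambda>x. (e$1 * x$2 - e$2 * x$1) / D"])
    show "linear (\<lambda>x::real^2. (x$1 * f$2 - x$2 * f$1) / D)" "linear (\<lambda>x::real^2. (e$1 * x$2 - e$2 * x$1) / D)"
      by (auto intro!: linearI simp: diff_divide_distrib add_divide_distrib algebra_simps)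
    show "x = ((x$1 * f$2 - x$2 * f$1) / D) *\<^sub>R e + ((e$1 * x$2 - e$2 * x$1) / D) *\<^sub>R f" for x
    proof -
      have "D *\<^sub>R x = (x$1 * f$2 - x$2 * f$1) *\<^sub>R e + (e$1 * x$2 - e$2 * x$1) *\<^sub>R f"
        by (simp add: vec_eq_iff forall_2 D_def algebra_simps)
      then have "(1 / D) *\<^sub>R (D *\<^sub>R x) = (1 / D) *\<^sub>R ((x$1 * f$2 - x$2 * f$1) *\<^sub>R e + (e$1 * x$2 - e$2 * x$1) *\<^sub>R f)"
        by simp
      then show ?thesis using D by (simp add: scaleR_add_right)
    qed
    show "(e$1 * f$2 - e$2 * f$1) / D = 1" "(e$1 * f$2 - e$2 * f$1) / D = 1"
      using D by (simp_all add: D_def)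
  qed simp_all
qed

section \<open>Geometry of the kite\<close>

text \<open>
  In coordinates \<open>s\<close>, \<open>t\<close> along the two diagonals, the kite with vertices \<open>(\<alpha>, 0)\<close>, \<open>(- \<beta>, 0)\<close>, \<open>(0, \<gamma>)\<close>,
  \<open>(0, - \<delta>)\<close> is the unit sublevel set of \<open>gauge\<close>. A segment joining points on opposite sides of a
  diagonal has its relative interior in \<open>gauge < 1\<close>, by the kink of \<open>tent\<close> at 0.
\<close>

locale kite =
  fixes s t :: "'a::real_normed_vector \<Rightarrow> real" and \<alpha> \<beta> \<gamma> \<delta> :: real
  assumes s_affine: "s ((1 - l) *\<^sub>R x + l *\<^sub>R y) = (1 - l) * s x + l * s y"
    and t_affine: "t ((1 - l) *\<^sub>R x + l *\<^sub>R y) = (1 - l) * t x + l * t y"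
    and pos: "0 < \<alpha>" "0 < \<beta>" "0 < \<gamma>" "0 < \<delta>"
begin

definition gauge :: "'a \<Rightarrow> real" where
  "gauge x = tent \<alpha> \<beta> (s x) + tent \<gamma> \<delta> (t x)"

lemma gauge_convex:
  assumes "gauge x \<le> 1" "gauge y \<le> 1" "z \<in> closed_segment x y"
  shows "gauge z \<le> 1"
proof -
  obtain l where l: "0 \<le> l" "l \<le> 1" "z = (1 - l) *\<^sub>R x + l *\<^sub>R y"
    using assms(3) by (auto simp: in_segment)
  have "gauge z \<le> (1 - l) * gauge x + l * gauge y"
    using tent_convex[OF l(1,2), of \<alpha> \<beta> "s x" "s y"] tent_convex[OF l(1,2), of \<gamma> \<delta> "t x" "t y"]
    unfolding gauge_def l(3) s_affine t_affine by (simp add: algebra_simps)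
  also have "\<dots> \<le> (1 - l) * 1 + l * 1"
    using assms l by (intro add_mono mult_left_mono) auto
  finally show ?thesis by simp
qed

lemma gauge_strict:
  assumes "gauge x \<le> 1" "gauge y \<le> 1" "s x * s y < 0 \<or> t x * t y < 0" "z \<in> open_segment x y"
  shows "gauge z < 1"
proof -
  obtain l where l: "0 < l" "l < 1" "z = (1 - l) *\<^sub>R x + l *\<^sub>R y"
    using assms(4) by (auto simp: in_segment)
  have "gauge z < (1 - l) * gauge x + l * gauge y"
    using tent_convex[of l \<alpha> \<beta> "s x" "s y"] tent_convex[of l \<gamma> \<delta> "t x" "t y"]
      tent_strictly_convex[OF l(1,2), of \<alpha> \<beta> "s x" "s y"]
      tent_strictly_convex[OF l(1,2), of \<gamma> \<delta> "t x" "t y"] assms(3) l(1,2) pos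
    unfolding gauge_def l(3) s_affine t_affine by (auto simp: distrib_left)
  also have "\<dots> \<le> (1 - l) * 1 + l * 1"
    using assms l by (intro add_mono mult_left_mono) auto
  finally show ?thesis by simp
qed

text \<open>Linear interpolation of \<open>s\<close> finds the point and convexity keeps it in the
  kite. This is how a segment is shown to cross the diagonal \<open>s = 0\<close>, which will be
  part of the crossed segment.\<close>

lemma zero_crossing:
  assumes "0 < s y" "s z \<le> 0" "gauge y \<le> 1" "gauge z \<le> 1"
  obtains m where "0 < m" "m \<le> 1" "s y * (1 - m) + m * s z = 0"
    "s ((1 - m) *\<^sub>R y + m *\<^sub>R z) = 0" "gauge ((1 - m) *\<^sub>R y + m *\<^sub>R z) \<le> 1"
proof
  let ?m = "s y / (s y - s z)"
  show m: "0 < ?m" "?m \<le> 1" using assms by (auto simp: divide_simps)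
  show eq: "s y * (1 - ?m) + ?m * s z = 0" using assms by (simp add: field_simps)
  then show "s ((1 - ?m) *\<^sub>R y + ?m *\<^sub>R z) = 0" by (simp only: s_affine) (simp add: mult.commute)
  show "gauge ((1 - ?m) *\<^sub>R y + ?m *\<^sub>R z) \<le> 1"
    using assms(3,4) by (rule gauge_convex) (use m in \<open>simp only: in_segment, blast intro: less_imp_le\<close>)
qed

text \<open>The function \<open>g\<close>, later the distance from the crossed segment, vanishes
  where the segment meets the diagonal. By convexity and nonnegativity it cannot exceed
  \<open>g y\<close> between \<open>y\<close> and that crossing.\<close>

lemma sublevel_half:
  assumes g: "\<And>x y l. 0 \<le> l \<Longrightarrow> l \<le> 1 \<Longrightarrow> g ((1 - l) *\<^sub>R x + l *\<^sub>R y) \<le> (1 - l) * g x + l * g y"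
    and g0: "\<And>x. gauge x \<le> 1 \<Longrightarrow> s x = 0 \<Longrightarrow> g x = 0" and gn: "\<And>x. 0 \<le> g x"
    and yz: "gauge y \<le> 1" "gauge z \<le> 1" "0 < s y" "s z \<le> 0" "g y \<le> \<kappa>"
    and l: "0 \<le> l" "l \<le> 1" and x: "0 < s ((1 - l) *\<^sub>R y + l *\<^sub>R z)"
  shows "g ((1 - l) *\<^sub>R y + l *\<^sub>R z) \<le> \<kappa>"
proof -
  obtain m where m: "0 < m" "m \<le> 1" "s y * (1 - m) + m * s z = 0"
    "s ((1 - m) *\<^sub>R y + m *\<^sub>R z) = 0" "gauge ((1 - m) *\<^sub>R y + m *\<^sub>R z) \<le> 1"
    using zero_crossing yz by metis
  \<comment> \<open>\<open>k\<close> is the parameter of the same point on the shorter segment from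
    \<open>y\<close> to the crossing. It is at most 1 because \<open>s\<close> is still positive
    there.\<close>
  define k where "k = l / m"
  have lk: "l = k * m" using m by (simp add: k_def)
  have k0: "0 \<le> k" using l m by (simp add: k_def)
  have "l * (s y - s z) < m * (s y - s z)"
    using x m(3) unfolding s_affine by (simp add: algebra_simps)
  then have "l < m" using yz by (simp add: mult_less_cancel_right)
  then have k1: "k \<le> 1" using m by (simp add: k_def)
  have "(1 - l) *\<^sub>R y + l *\<^sub>R z = (1 - k) *\<^sub>R y + k *\<^sub>R ((1 - m) *\<^sub>R y + m *\<^sub>R z)"
    by (simp add: lk algebra_simps)
  then have "g ((1 - l) *\<^sub>R y + l *\<^sub>R z) \<le> (1 - k) * g y"
    using g[OF k0 k1, of y "(1 - m) *\<^sub>R y + m *\<^sub>R z"] g0[OF m(5,4)] by simp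
  also have "\<dots> \<le> g y" using k0 k1 gn[of y] by (simp add: mult_left_le_one_le)
  finally show ?thesis using yz by simp
qed

lemma sublevel_segment:
  assumes g: "\<And>x y l. 0 \<le> l \<Longrightarrow> l \<le> 1 \<Longrightarrow> g ((1 - l) *\<^sub>R x + l *\<^sub>R y) \<le> (1 - l) * g x + l * g y"
    and g0: "\<And>x. gauge x \<le> 1 \<Longrightarrow> s x = 0 \<Longrightarrow> g x = 0" and gn: "\<And>x. 0 \<le> g x"
    and yz: "gauge y \<le> 1" "gauge z \<le> 1" "0 < s y \<Longrightarrow> g y \<le> \<kappa>" "0 < s z \<Longrightarrow> g z \<le> \<kappa>"
    and x: "x \<in> closed_segment y z" "0 < s x"
  shows "g x \<le> \<kappa>"
proof -
  obtain l where l: "0 \<le> l" "l \<le> 1" "x = (1 - l) *\<^sub>R y + l *\<^sub>R z"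
    using x by (auto simp: in_segment)
  have sx: "0 < (1 - l) * s y + l * s z" using x l by (simp add: s_affine)
  consider "0 < s y" "0 < s z" | "0 < s y" "s z \<le> 0" | "s y \<le> 0" "0 < s z"
  proof -
    have "\<not> (s y \<le> 0 \<and> s z \<le> 0)"
      using sx l by (smt (verit) mult_nonneg_nonpos)
    then show ?thesis using that by linarith
  qed
  then show ?thesis
  proof cases
    case 1
    then have "g x \<le> (1 - l) * \<kappa> + l * \<kappa>"
      unfolding l(3) using g[OF l(1,2)] l yz by (intro order.trans[OF g] add_mono mult_left_mono) auto
    then show ?thesis by (simp add: algebra_simps)
  next
    case 2
    then show ?thesis using sublevel_half[OF g g0 gn yz(1,2)] yz l x by blast
  next
    case 3
    have eq: "x = (1 - (1 - l)) *\<^sub>R z + (1 - l) *\<^sub>R y" by (simp add: l(3) add.commute)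
    have "g ((1 - (1 - l)) *\<^sub>R z + (1 - l) *\<^sub>R y) \<le> \<kappa>"
    proof (rule sublevel_half[OF g g0 gn yz(2,1)])
      show "0 < s ((1 - (1 - l)) *\<^sub>R z + (1 - l) *\<^sub>R y)" using x(2) unfolding eq .
    qed (use 3 yz(4) l in simp_all)
    then show ?thesis unfolding eq .
  qed
qed

text \<open>The half \<open>s \<ge> 0\<close> of the kite is a triangle with apex \<open>a\<close>
  and base on the other diagonal; \<open>q\<close> is the projection of \<open>c\<close> from
  \<open>a\<close> to that base. The gauge bound gives
  \<open>tent \<gamma> \<delta> (t c) \<le> l\<close>, so stretching by \<open>1 / l\<close> stays
  in the kite, and \<open>l = 0\<close> would force \<open>c = a\<close>.\<close>

lemma axis_decomposition:
  assumes a: "s a = \<alpha>" "t a = 0" and inj: "\<And>x y. s x = s y \<Longrightarrow> t x = t y \<Longrightarrow> x = y"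
    and c: "gauge c \<le> 1" "0 \<le> s c" "c \<noteq> a"
  obtains l q where "0 < l" "l \<le> 1" "c = (1 - l) *\<^sub>R a + l *\<^sub>R q" "s q = 0" "gauge q \<le> 1"
proof -
  define l where "l = 1 - s c / \<alpha>"
  have tl: "tent \<gamma> \<delta> (t c) \<le> l"
    using c tent_eq_pos[OF pos(1,2), of "s c"] by (simp add: gauge_def l_def)
  have l1: "l \<le> 1" using c pos by (simp add: l_def)
  have "l \<noteq> 0"
  proof
    assume "l = 0"
    then have "s c = s a" using pos a by (simp add: l_def)
    moreover have "t c = 0"
    proof (rule ccontr)
      assume "t c \<noteq> 0"
      then have "0 < tent \<gamma> \<delta> (t c)"
        using pos by (cases "0 < t c") (auto simp: tent_eq_pos tent_eq_neg divide_neg_pos)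
      then show False using tl \<open>l = 0\<close> by simp
    qed
    ultimately show False using inj[of c a] a c by simp
  qed
  then have l0: "0 < l" using tl tent_nonneg[OF pos(3,4), of "t c"] by simp
  define q where "q = (1 - 1 / l) *\<^sub>R a + (1 / l) *\<^sub>R c"
  have "s q = (1 - 1 / l) * \<alpha> + (1 / l) * (\<alpha> * (1 - l))"
    using pos by (simp add: q_def s_affine a(1)) (simp add: l_def)
  then have sq: "s q = 0" using l0 by (simp add: field_simps)
  have "t q = (1 / l) * t c" by (simp add: q_def t_affine a)
  then have "tent \<gamma> \<delta> (t q) = (1 / l) * tent \<gamma> \<delta> (t c)"
    using l0 by (simp only: tent_scale zero_le_divide_1_iff less_imp_le)
  then have "gauge q \<le> 1" using tl l0 by (simp add: gauge_def sq) (simp add: tent_def)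
  moreover have "c = (1 - l) *\<^sub>R a + l *\<^sub>R q"
    using l0 by (simp add: q_def algebra_simps)
  ultimately show thesis using that l0 l1 sq by blast
qed

text \<open>Contacts on the side of \<open>a\<close> have \<open>g\<close> at most
  \<open>g a - \<epsilon>\<close>, and convexity carries the bound to the part of the segment
  \<open>y z\<close> with \<open>s > 0\<close>. A point of \<open>A\<close> there would improve on
  \<open>a\<close> by \<epsilon> as an end of a segment to \<open>b\<close> that crosses
  \<open>Q\<close> and avoids \<open>F\<close>, against \<open>opt\<close>.\<close>

lemma segment_avoids_side_region:
  assumes a: "s a = \<alpha>" "t a = 0" and b: "s b = - \<beta>" "t b = 0"
    and inj: "\<And>x y. s x = s y \<Longrightarrow> t x = t y \<Longrightarrow> x = y"
    and Q: "\<And>x. gauge x \<le> 1 \<Longrightarrow> s x = 0 \<Longrightarrow> x \<in> Q"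
    and A: "convex A" "a \<in> A" "A \<inter> Q = {}" "A \<inter> F = {}"
    and F: "\<And>x. x \<in> F \<Longrightarrow> 1 \<le> gauge x" "b \<notin> F"
    and g: "\<And>x y l. 0 \<le> l \<Longrightarrow> l \<le> 1 \<Longrightarrow> g ((1 - l) *\<^sub>R x + l *\<^sub>R y) \<le> (1 - l) * g x + l * g y"
    and g0: "\<And>x. x \<in> Q \<Longrightarrow> g x = 0" and gn: "\<And>x. 0 \<le> g x"
    and opt: "\<And>x. x \<in> A \<Longrightarrow> closed_segment x b \<inter> F = {} \<Longrightarrow> closed_segment x b \<inter> Q \<noteq> {} \<Longrightarrow> g a < g x + \<epsilon>"
    and \<epsilon>: "\<And>c q. c \<in> F \<Longrightarrow> q \<in> Q \<Longrightarrow> \<epsilon> * dist a q \<le> g a * dist a c"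
    and y: "y \<in> F \<and> gauge y \<le> 1 \<or> y = b" and z: "z \<in> F \<and> gauge z \<le> 1 \<or> z = b"
  shows "closed_segment y z \<inter> A = {}"
proof -
  have Na: "gauge a \<le> 1" and Nb: "gauge b \<le> 1"
    using pos by (auto simp: gauge_def a b tent_eq_pos tent_eq_neg)
  \<comment> \<open>Writing \<open>c\<close> as a combination of \<open>a\<close> and
    \<open>q\<close> in \<open>Q\<close> with weight \<open>l\<close> on \<open>q\<close> gives
    \<open>dist a c = l * dist a q\<close>. The assumption on \<epsilon> then reads
    \<open>\<epsilon> \<le> g a * l\<close>, while convexity and \<open>g q = 0\<close> give
    \<open>g c \<le> (1 - l) * g a\<close>.\<close>
  have low: "g c \<le> g a - \<epsilon>" if c: "c \<in> F" "gauge c \<le> 1" "0 < s c" for c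
  proof -
    have "c \<noteq> a" using A c by blast
    obtain l q where l: "0 < l" "l \<le> 1" "c = (1 - l) *\<^sub>R a + l *\<^sub>R q" "s q = 0" "gauge q \<le> 1"
      using axis_decomposition[OF a inj c(2) less_imp_le[OF c(3)] \<open>c \<noteq> a\<close>] by blast
    have q: "q \<in> Q" using Q l by simp
    then have "a \<noteq> q" using A by blast
    have "a - c = l *\<^sub>R (a - q)" by (simp add: l(3) algebra_simps)
    then have "dist a c = l * dist a q" using l by (simp add: dist_norm)
    then have "\<epsilon> * dist a q \<le> (g a * l) * dist a q" using \<epsilon>[OF c(1) q] by (simp add: mult.assoc)
    then have "\<epsilon> \<le> g a * l" using \<open>a \<noteq> q\<close> by (simp add: mult_le_cancel_right)
    moreover have "g c \<le> (1 - l) * g a" using g[of l a q] l g0[OF q] by simp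
    ultimately show ?thesis by (simp add: algebra_simps)
  qed
  have False if x: "x \<in> closed_segment y z" "x \<in> A" for x
  proof -
    have Nyz: "gauge y \<le> 1" "gauge z \<le> 1" using y z Nb by auto
    have Nx: "gauge x \<le> 1" using gauge_convex[OF Nyz x(1)] .
    \<comment> \<open>Otherwise the segment from \<open>a\<close> to \<open>x\<close>, which lies in
      the convex \<open>A\<close>, would cross the diagonal and so meet \<open>Q\<close>.\<close>
    have sx: "0 < s x"
    proof (rule ccontr)
      assume "\<not> ?thesis"
      then obtain m where m: "0 < m" "m \<le> 1" 
         "s ((1 - m) *\<^sub>R a + m *\<^sub>R x) = 0" "gauge ((1 - m) *\<^sub>R a + m *\<^sub>R x) \<le> 1"
        using zero_crossing[of a x] a pos Na Nx by (metis not_less)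
      then have "(1 - m) *\<^sub>R a + m *\<^sub>R x \<in> A"
        using A x by (simp add: convexD_alt)
      then show False using Q m A by blast
    qed
    have "g x \<le> g a - \<epsilon>"
    proof (rule sublevel_segment[OF g _ gn Nyz _ _ x(1) sx])
      show "0 < s y \<Longrightarrow> g y \<le> g a - \<epsilon>" using y low b pos by auto
      show "0 < s z \<Longrightarrow> g z \<le> g a - \<epsilon>" using z low b pos by auto
    qed (use Q g0 in auto)
    \<comment> \<open>Since \<open>x\<close> and \<open>b\<close> lie on opposite sides of the
      diagonal, the open segment between them has gauge below 1 and misses \<open>F\<close>, and it
      crosses \<open>Q\<close>.\<close>
    moreover have "g a < g x + \<epsilon>"
    proof (rule opt[OF x(2)])
      have "s x * s b < 0" using sx b pos by (simp add: mult_less_0_iff)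
      then have "u \<notin> F" if "u \<in> open_segment x b" for u
        using gauge_strict[OF Nx Nb _ that] F(1)[of u] by auto
      moreover have "x \<notin> F" "b \<notin> F" using A x F by auto
      ultimately show "closed_segment x b \<inter> F = {}"
        unfolding closed_segment_eq_open by blast
      obtain m where m: "0 < m" "m \<le> 1" 
         "s ((1 - m) *\<^sub>R x + m *\<^sub>R b) = 0" "gauge ((1 - m) *\<^sub>R x + m *\<^sub>R b) \<le> 1"
        using zero_crossing[of x b] sx b pos Nb Nx by (metis neg_le_0_iff_le less_imp_le)
      moreover have "(1 - m) *\<^sub>R x + m *\<^sub>R b \<in> closed_segment x b"
        using m unfolding in_segment by (intro exI[of _ m]) simp
      ultimately show "closed_segment x b \<inter> Q \<noteq> {}" using Q by blast
    qed
    ultimately show False by simp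
  qed
  then show ?thesis by blast
qed

text \<open>If \<open>s c < 0\<close>, the segment passes through the interior of the kite, which is
  free of \<open>F\<close>. Otherwise \<open>s c < \<alpha>\<close>, so \<open>s\<close> grows
  strictly towards \<open>a\<close>, and a further contact would contradict the maximality of
  \<open>s c\<close> among contacts on its side of the axis.\<close>

lemma contact_sees_vertex:
  assumes a: "s a = \<alpha>" "t a = 0" "a \<notin> F" and F: "\<And>x. x \<in> F \<Longrightarrow> 1 \<le> gauge x"
    and c: "gauge c \<le> 1" "t c \<noteq> 0"
    and max: "s c < 0 \<or> (\<forall>x\<in>F. 0 \<le> t x * t c \<longrightarrow> gauge x \<le> 1 \<longrightarrow> s x \<le> s c)"
    and x: "x \<in> closed_segment c a" "x \<in> F"
  shows "x = c"
proof (rule ccontr)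
  assume "x \<noteq> c"
  have Na: "gauge a \<le> 1" using pos by (auto simp: gauge_def a tent_eq_pos)
  have xo: "x \<in> open_segment c a" using x a \<open>x \<noteq> c\<close> by (auto simp: open_segment_def)
  show False
  proof (cases "s c < 0")
    case True
    then have "s c * s a < 0" using a pos by (simp add: mult_less_0_iff)
    then show False using gauge_strict[OF c(1) Na _ xo] F[OF x(2)] by simp
  next
    case False
    obtain l where l: "0 < l" "l < 1" "x = (1 - l) *\<^sub>R c + l *\<^sub>R a"
      using xo by (auto simp: in_segment)
    have "0 < tent \<gamma> \<delta> (t c)"
      using c pos by (cases "0 < t c") (auto simp: tent_eq_pos tent_eq_neg divide_neg_pos)
    then have "s c / \<alpha> < 1" using False c tent_eq_pos[OF pos(1,2), of "s c"] by (simp add: gauge_def)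
    then have "s c < \<alpha>" using pos by simp
    have "t x * t c = (1 - l) * (t c * t c)" by (simp add: l(3) t_affine a)
    then have "0 \<le> t x * t c" by (simp only:) (use l in simp)
    then have "s x \<le> s c" using max False x gauge_convex[OF c(1) Na x(1)] by auto
    then have "l * \<alpha> \<le> l * s c" unfolding l(3) s_affine a by (simp add: algebra_simps)
    then show False using l \<open>s c < \<alpha>\<close> by simp
  qed
qed

text \<open>Reflection exchanges the roles of \<open>a\<close> and \<open>b\<close>, so that results
  about one end of the axis transfer to the other.\<close>

lemma mirror: "kite (\<lambda>x. - s x) t \<beta> \<alpha> \<gamma> \<delta>"
  by unfold_locales (use pos in \<open>auto simp: s_affine t_affine\<close>)

lemma gauge_mirror: "kite.gauge (\<lambda>x. - s x) t \<beta> \<alpha> \<gamma> \<delta> = gauge"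
  by (rule ext) (simp add: kite.gauge_def[OF mirror] gauge_def tent_uminus)

end


section \<open>Building the kite at a crossing\<close>

lemma ray_segment_cases:
  fixes p x y :: "'a::real_vector"
  assumes "0 < k" "y - p = k *\<^sub>R (x - p)"
  shows "y \<in> closed_segment p x \<or> x \<in> closed_segment p y"
proof (cases "k \<le> 1")
  case True
  have "y = (1 - k) *\<^sub>R p + k *\<^sub>R x" using assms(2) by (simp add: algebra_simps)
  then show ?thesis using True assms(1) unfolding in_segment by (metis less_imp_le)
next
  case False
  have "x - p = (1 / k) *\<^sub>R (y - p)" using assms by simp
  then have "x = (1 - 1 / k) *\<^sub>R p + (1 / k) *\<^sub>R y" by (simp add: algebra_simps)
  moreover have "0 \<le> 1 / k" "1 / k \<le> 1" using False by auto
  ultimately show ?thesis unfolding in_segment by blast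
qed

lemma open_segment_opposite:
  fixes p x y :: "'a::real_vector"
  assumes "p \<in> open_segment x y"
  obtains k where "0 < k" "y - p = - (k *\<^sub>R (x - p))"
proof -
  obtain m where m: "0 < m" "m < 1" "p = (1 - m) *\<^sub>R x + m *\<^sub>R y"
    using assms by (auto simp: in_segment)
  have "m *\<^sub>R (y - p) = - ((1 - m) *\<^sub>R (x - p))"
    by (subst (1 2) m(3)) (simp add: algebra_simps)
  then have "(1 / m) *\<^sub>R (m *\<^sub>R (y - p)) = (1 / m) *\<^sub>R - ((1 - m) *\<^sub>R (x - p))" by simp
  then have "y - p = - (((1 - m) / m) *\<^sub>R (x - p))" using m by simp
  then show thesis using that[of "(1 - m) / m"] m by simp
qed

text \<open>The geometric core, with all regions other than the two at the ends of \<open>ab\<close>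
  merged into \<open>F\<close>. That the midpoint of \<open>c\<close> and \<open>d\<close> avoids
  \<open>F\<close> will later separate the regions of \<open>c\<close> and \<open>d\<close>.\<close>

lemma crossing_contacts:
  fixes a b v w :: "real^2" and A B F :: "(real^2) set" and \<epsilon> :: real
  defines "Q \<equiv> closed_segment v w"
  defines "g \<equiv> \<lambda>x. infdist x Q"
  assumes A: "convex A" "a \<in> A" "A \<inter> Q = {}" "A \<inter> F = {}"
    and B: "convex B" "b \<in> B" "B \<inter> Q = {}" "B \<inter> F = {}"
    and F: "compact F" "v \<in> F" "w \<in> F"
    and ab: "closed_segment a b \<inter> F = {}" "closed_segment a b \<inter> Q \<noteq> {}"
    and optA: "\<And>x. x \<in> A \<Longrightarrow> closed_segment x b \<inter> F = {} \<Longrightarrow> closed_segment x b \<inter> Q \<noteq> {} \<Longrightarrow> g a < g x + \<epsilon>"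
    and optB: "\<And>x. x \<in> B \<Longrightarrow> closed_segment x a \<inter> F = {} \<Longrightarrow> closed_segment x a \<inter> Q \<noteq> {} \<Longrightarrow> g b < g x + \<epsilon>"
    and \<epsilon>A: "\<And>c q. c \<in> F \<Longrightarrow> q \<in> Q \<Longrightarrow> \<epsilon> * dist a q \<le> g a * dist a c"
    and \<epsilon>B: "\<And>c q. c \<in> F \<Longrightarrow> q \<in> Q \<Longrightarrow> \<epsilon> * dist b q \<le> g b * dist b c"
  obtains c d where "c \<in> F" "d \<in> F" "midpoint c d \<notin> F" "closed_segment c d \<inter> F \<subseteq> {c, d}"
    "closed_segment c d \<inter> (A \<union> B) = {}"
    "\<And>e. e \<in> {c, d} \<Longrightarrow> closed_segment e a \<inter> B = {} \<and> closed_segment e a \<inter> F \<subseteq> {e}"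
    "\<And>e. e \<in> {c, d} \<Longrightarrow> closed_segment e b \<inter> A = {} \<and> closed_segment e b \<inter> F \<subseteq> {e}"
proof -
  obtain p where p: "p \<in> closed_segment a b" "p \<in> Q" using ab by blast
  have "p \<notin> A" "p \<notin> B" "p \<notin> F" using p A B ab by auto
  then have ne: "p \<noteq> a" "p \<noteq> b" "p \<noteq> v" "p \<noteq> w" using A B F by auto
  have "p \<in> open_segment a b" "p \<in> open_segment v w"
    using p ne by (auto simp: open_segment_def Q_def)
  then obtain \<beta> \<omega> where \<beta>: "0 < \<beta>" "b - p = - (\<beta> *\<^sub>R (a - p))" and \<omega>: "0 < \<omega>" "w - p = - (\<omega> *\<^sub>R (v - p))"
    using open_segment_opposite by metis
  have sub: "closed_segment p a \<subseteq> closed_segment a b" "closed_segment p b \<subseteq> closed_segment a b"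
    "closed_segment p v \<subseteq> Q"
    using p by (auto simp: Q_def subset_closed_segment)
  \<comment> \<open>If the lines were parallel, \<open>v\<close> would lie on the ray from
    \<open>p\<close> through \<open>a\<close> or through \<open>b\<close>. Then either
    \<open>v\<close>, a point of \<open>F\<close>, lies on \<open>ab\<close>, or that end of
    \<open>ab\<close> lies on \<open>Q\<close>.\<close>
  have indep: "v - p \<noteq> k *\<^sub>R (a - p)" for k
  proof
    assume eq: "v - p = k *\<^sub>R (a - p)"
    then have "k \<noteq> 0" using ne by auto
    then consider "0 < k" | "0 < - k / \<beta>" using \<beta>(1) by (cases "0 < k") (auto simp: divide_neg_pos)
    then show False
    proof cases
      case 1
      from ray_segment_cases[OF this eq] show False using sub ab A F by blast
    next
      case 2
      have "v - p = (- k / \<beta>) *\<^sub>R (b - p)" using eq \<beta> by simp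
      from ray_segment_cases[OF 2 this] show False using sub ab B F by blast
    qed
  qed
  obtain S T :: "real^2 \<Rightarrow> real" where lin: "linear S" "linear T"
    and rep: "\<And>x. x = S x *\<^sub>R (a - p) + T x *\<^sub>R (v - p)"
    and ST: "S (a - p) = 1" "T (a - p) = 0" "S (v - p) = 0" "T (v - p) = 1"
    using coordinate_functionals[of "a - p" "v - p"] indep ne by auto
  \<comment> \<open>With origin \<open>p\<close> and basis \<open>a - p\<close>,
    \<open>v - p\<close>, the points \<open>a\<close>, \<open>b\<close>, \<open>v\<close>,
    \<open>w\<close> become \<open>(1, 0)\<close>, \<open>(- \<beta>, 0)\<close>,
    \<open>(0, 1)\<close>, \<open>(0, - \<omega>)\<close>.\<close>
  define s t where "s x = S (x - p)" and "t x = T (x - p)" for x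
  have aff: "s ((1 - l) *\<^sub>R x + l *\<^sub>R y) = (1 - l) * s x + l * s y"
            "t ((1 - l) *\<^sub>R x + l *\<^sub>R y) = (1 - l) * t x + l * t y" for l x y
  proof -
    have "(1 - l) *\<^sub>R x + l *\<^sub>R y - p = (1 - l) *\<^sub>R (x - p) + l *\<^sub>R (y - p)"
      by (simp add: algebra_simps)
    then show "s ((1 - l) *\<^sub>R x + l *\<^sub>R y) = (1 - l) * s x + l * s y"
            "t ((1 - l) *\<^sub>R x + l *\<^sub>R y) = (1 - l) * t x + l * t y"
      unfolding s_def t_def by (simp_all only: linear_add[OF lin(1)] linear_add[OF lin(2)]
          linear_scale[OF lin(1)] linear_scale[OF lin(2)] real_scaleR_def)
  qed
  have inj: "x = y" if "s x = s y" "t x = t y" for x y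
    using rep[of "x - p"] rep[of "y - p"] that unfolding s_def t_def by (metis diff_add_cancel)
  have co: "s a = 1" "t a = 0" "s b = - \<beta>" "t b = 0" "s v = 0" "t v = 1" "s w = 0" "t w = - \<omega>"
    unfolding s_def t_def \<beta>(2) \<omega>(2)
    by (simp_all add: ST linear_neg[OF lin(1)] linear_neg[OF lin(2)] linear_scale[OF lin(1)] linear_scale[OF lin(2)])
  have cont: "continuous_on F s" "continuous_on F t"
    unfolding s_def t_def
    by (auto intro!: continuous_intros linear_continuous_on_compose[OF _ lin(1)] linear_continuous_on_compose[OF _ lin(2)])
  have base: "1 < tent 1 \<beta> (s x)" if "x \<in> F" "t x = 0" for x
  proof (rule ccontr)
    assume "\<not> ?thesis"
    then have u: "s x \<le> 1" "- \<beta> \<le> s x" using tent_le_one[of 1 \<beta> "s x"] \<beta>(1) by auto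
    define l where "l = (1 - s x) / (1 + \<beta>)"
    have l: "0 \<le> l" "l \<le> 1" using u \<beta>(1) by (auto simp: l_def)
    have "l * (1 + \<beta>) = 1 - s x" using \<beta>(1) by (simp add: l_def)
    then have "x = (1 - l) *\<^sub>R a + l *\<^sub>R b"
      by (intro inj; simp only: aff co that; simp add: algebra_simps)
    then have "x \<in> closed_segment a b" using l unfolding in_segment by blast
    then show False using that ab by blast
  qed
  obtain \<gamma> c' where up: "0 < \<gamma>" "\<gamma> \<le> 1" "c' \<in> (\<lambda>x. (s x, t x)) ` F" "0 < snd c'"
      "tent 1 \<beta> (fst c') + snd c' / \<gamma> \<le> 1"
    "\<And>x. x \<in> (\<lambda>x. (s x, t x)) ` F \<Longrightarrow> 0 \<le> snd x \<Longrightarrow> 1 \<le> tent 1 \<beta> (fst x) + snd x / \<gamma>"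
    "0 < fst c' \<or> (\<forall>x\<in>(\<lambda>x. (s x, t x)) ` F. 0 \<le> snd x \<longrightarrow> tent 1 \<beta> (fst x) + snd x / \<gamma> \<le> 1 \<longrightarrow> fst c' \<le> fst x)"
    "fst c' < 0 \<or> (\<forall>x\<in>(\<lambda>x. (s x, t x)) ` F. 0 \<le> snd x \<longrightarrow> tent 1 \<beta> (fst x) + snd x / \<gamma> \<le> 1 \<longrightarrow> fst x \<le> fst c')"
  proof (rule first_contact[of "(\<lambda>x. (s x, t x)) ` F" 1 \<beta>])
    show "compact ((\<lambda>x. (s x, t x)) ` F)"
      by (intro compact_continuous_image continuous_on_Pair cont F)
    show "(0, 1) \<in> (\<lambda>x. (s x, t x)) ` F" using F co by force
  qed (use \<beta> base in auto)
  obtain c where c: "c \<in> F" "c' = (s c, t c)" using up(3) by auto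
  \<comment> \<open>The lower side is reflected and rescaled by \<omega> so that \<open>w\<close>
    lands on \<open>(0, 1)\<close>. In the original coordinates the contact height is thus
    \<open>\<omega> * \<tau>\<close>.\<close>
  obtain \<tau> d' where dn: "0 < \<tau>" "\<tau> \<le> 1" "d' \<in> (\<lambda>x. (s x, - t x / \<omega>)) ` F" "0 < snd d'"
      "tent 1 \<beta> (fst d') + snd d' / \<tau> \<le> 1"
    "\<And>x. x \<in> (\<lambda>x. (s x, - t x / \<omega>)) ` F \<Longrightarrow> 0 \<le> snd x \<Longrightarrow> 1 \<le> tent 1 \<beta> (fst x) + snd x / \<tau>"
    "0 < fst d' \<or> (\<forall>x\<in>(\<lambda>x. (s x, - t x / \<omega>)) ` F. 0 \<le> snd x \<longrightarrow> tent 1 \<beta> (fst x) + snd x / \<tau> \<le> 1 \<longrightarrow> fst d' \<le> fst x)"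
    "fst d' < 0 \<or> (\<forall>x\<in>(\<lambda>x. (s x, - t x / \<omega>)) ` F. 0 \<le> snd x \<longrightarrow> tent 1 \<beta> (fst x) + snd x / \<tau> \<le> 1 \<longrightarrow> fst x \<le> fst d')"
  proof (rule first_contact[of "(\<lambda>x. (s x, - t x / \<omega>)) ` F" 1 \<beta>])
    show "compact ((\<lambda>x. (s x, - t x / \<omega>)) ` F)"
      using \<omega>(1) by (intro compact_continuous_image continuous_intros cont F) auto
    show "(0, 1) \<in> (\<lambda>x. (s x, - t x / \<omega>)) ` F" using F(3) co \<omega>(1) by force
  qed (use \<beta> \<omega> base in auto)
  obtain d where d: "d \<in> F" "d' = (s d, - t d / \<omega>)" using dn(3) by auto
  define \<delta> where "\<delta> = \<omega> * \<tau>"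
  have \<delta>: "0 < \<delta>" "\<delta> \<le> \<omega>" using \<omega>(1) dn(1,2) by (auto simp: \<delta>_def)
  interpret K: kite s t 1 \<beta> \<gamma> \<delta>
    by unfold_locales (use aff \<beta> up(1) \<delta> in auto)
  interpret M: kite "\<lambda>x. - s x" t \<beta> 1 \<gamma> \<delta>
    by (rule K.mirror)
  have gpos: "K.gauge x = tent 1 \<beta> (s x) + t x / \<gamma>" if "0 \<le> t x" for x
    unfolding K.gauge_def using tent_eq_pos[OF K.pos(3,4) that] by simp
  have gneg: "K.gauge x = tent 1 \<beta> (s x) + (- t x / \<omega>) / \<tau>" if "t x \<le> 0" for x
    unfolding K.gauge_def using tent_eq_neg[OF K.pos(3,4) that] by (simp add: \<delta>_def)
  have dnt: "0 \<le> - t x / \<omega> \<longleftrightarrow> t x \<le> 0" "0 < - t x / \<omega> \<longleftrightarrow> t x < 0" for x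
    using \<omega>(1) by (auto simp: divide_simps)
  have FK: "1 \<le> K.gauge x" if "x \<in> F" for x
  proof (cases "0 \<le> t x")
    case True
    then show ?thesis using up(6)[of "(s x, t x)"] that gpos by auto
  next
    case False
    then show ?thesis using dn(6)[of "(s x, - t x / \<omega>)"] that gneg dnt by auto
  qed
  have tc: "0 < t c" and td: "t d < 0" using up(4) dn(4) c d dnt by auto
  have Nc: "K.gauge c \<le> 1" and Nd: "K.gauge d \<le> 1" using up(5) dn(5) c d tc td gpos gneg by auto
  \<comment> \<open>The kite reaches no further than \<open>v\<close> and \<open>w\<close>, because
    \<gamma> is at most 1 and \<delta> at most \<omega>.\<close>
  have QK: "x \<in> Q" if "K.gauge x \<le> 1" "s x = 0" for x
  proof -
    have "tent \<gamma> \<delta> (t x) \<le> 1" using that by (simp add: K.gauge_def) (simp add: tent_def)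
    then have "t x \<le> \<gamma>" "- \<delta> \<le> t x" using tent_le_one[OF K.pos(3,4)] by auto
    then have u: "t x \<le> 1" "- \<omega> \<le> t x" using up(2) \<delta> by auto
    define l where "l = (1 - t x) / (1 + \<omega>)"
    have l: "0 \<le> l" "l \<le> 1" using u \<omega>(1) by (auto simp: l_def)
    have "l * (1 + \<omega>) = 1 - t x" using \<omega>(1) by (simp add: l_def)
    then have "x = (1 - l) *\<^sub>R v + l *\<^sub>R w"
      by (intro inj; simp only: aff co that; simp add: algebra_simps)
    then show ?thesis using l unfolding in_segment Q_def by blast
  qed
  have gconv: "g ((1 - l) *\<^sub>R x + l *\<^sub>R y) \<le> (1 - l) * g x + l * g y" if "0 \<le> l" "l \<le> 1" for l x y
    unfolding g_def using that by (intro infdist_convex) (auto simp: Q_def)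
  have g0: "g x = 0" if "x \<in> Q" for x using that by (simp add: g_def)
  have gn: "0 \<le> g x" for x by (simp add: g_def infdist_nonneg)
  have aF: "a \<notin> F" "b \<notin> F" using A B by auto
  have avA: "closed_segment y z \<inter> A = {}"
    if "y \<in> F \<and> K.gauge y \<le> 1 \<or> y = b" "z \<in> F \<and> K.gauge z \<le> 1 \<or> z = b" for y z
    by (rule K.segment_avoids_side_region[OF co(1-4) inj QK A FK aF(2) gconv g0 gn optA \<epsilon>A that])
  have avB: "closed_segment y z \<inter> B = {}"
    if "y \<in> F \<and> K.gauge y \<le> 1 \<or> y = a" "z \<in> F \<and> K.gauge z \<le> 1 \<or> z = a" for y z
    by (rule M.segment_avoids_side_region[where a = b and b = a and Q = Q and F = F and g = g and \<epsilon> = \<epsilon>,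
          unfolded K.gauge_mirror, OF _ co(4) _ co(2) _ _ B FK aF(1) gconv g0 gn optB \<epsilon>B that])
       (use co inj QK in auto)
  have upA: "s c < 0 \<or> (\<forall>x\<in>F. 0 \<le> t x * t c \<longrightarrow> K.gauge x \<le> 1 \<longrightarrow> s x \<le> s c)"
    using up(8) c gpos tc by (auto simp: zero_le_mult_iff)
  have upB: "- s c < 0 \<or> (\<forall>x\<in>F. 0 \<le> t x * t c \<longrightarrow> K.gauge x \<le> 1 \<longrightarrow> - s x \<le> - s c)"
    using up(7) c gpos tc by (auto simp: zero_le_mult_iff)
  have dnA: "s d < 0 \<or> (\<forall>x\<in>F. 0 \<le> t x * t d \<longrightarrow> K.gauge x \<le> 1 \<longrightarrow> s x \<le> s d)"
    using dn(8) d gneg dnt td by (auto simp: zero_le_mult_iff)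
  have dnB: "- s d < 0 \<or> (\<forall>x\<in>F. 0 \<le> t x * t d \<longrightarrow> K.gauge x \<le> 1 \<longrightarrow> - s x \<le> - s d)"
    using dn(7) d gneg dnt td by (auto simp: zero_le_mult_iff)
  have "u \<notin> F" if "u \<in> open_segment c d" for u
    using K.gauge_strict[OF Nc Nd _ that] FK[of u] tc td by (auto simp: mult_pos_neg)
  note cd = this
  show thesis
  proof (rule that[OF c(1) d(1)])
    have "c \<noteq> d" using tc td by auto
    then show "midpoint c d \<notin> F" using cd by simp
    show "closed_segment c d \<inter> F \<subseteq> {c, d}" using cd by (auto simp: closed_segment_eq_open)
    show "closed_segment c d \<inter> (A \<union> B) = {}" using avA[of c d] avB[of c d] c d Nc Nd by blast
    fix e assume "e \<in> {c, d}"
    then have e: "e \<in> F" "K.gauge e \<le> 1" "t e \<noteq> 0"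
       "s e < 0 \<or> (\<forall>x\<in>F. 0 \<le> t x * t e \<longrightarrow> K.gauge x \<le> 1 \<longrightarrow> s x \<le> s e)"
       "- s e < 0 \<or> (\<forall>x\<in>F. 0 \<le> t x * t e \<longrightarrow> K.gauge x \<le> 1 \<longrightarrow> - s x \<le> - s e)"
      using c d Nc Nd tc td upA upB dnA dnB
      by (metis insertE singletonD less_irrefl)+
    show "closed_segment e a \<inter> B = {} \<and> closed_segment e a \<inter> F \<subseteq> {e}"
      using avB[of e a] e K.contact_sees_vertex[OF co(1,2) aF(1) FK e(2,3,4)] by blast
    have "x = e" if "x \<in> closed_segment e b" "x \<in> F" for x
      by (rule M.contact_sees_vertex[where a = b and F = F, unfolded K.gauge_mirror, OF _ co(4) aF(2) FK e(2,3,5) that])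
        (simp add: co)
    then show "closed_segment e b \<inter> A = {} \<and> closed_segment e b \<inter> F \<subseteq> {e}"
      using avA[of e b] e by blast
  qed
qed

section \<open>Choice of a nearly optimal sightline and the resulting four vertices\<close>

lemma near_minimizer:
  fixes f :: "'a \<Rightarrow> real"
  assumes "x \<in> P" "\<And>x. x \<in> P \<Longrightarrow> 0 \<le> f x" "0 < \<epsilon>"
  obtains x where "x \<in> P" "\<And>y. y \<in> P \<Longrightarrow> f x < f y + \<epsilon>"
proof -
  have bdd: "bdd_below (f ` P)" using assms(2) by (intro bdd_belowI2)
  then obtain x where "x \<in> P" "f x < Inf (f ` P) + \<epsilon>"
    using assms cINF_less_iff[of P f "Inf (f ` P) + \<epsilon>"] by auto
  then show thesis using that cINF_lower[OF bdd] by (meson add_right_mono less_le_trans)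
qed

theorem theorem3:
  fixes Vs :: "'v set" and E :: "'v \<Rightarrow> 'v \<Rightarrow> bool" and R :: "'v \<Rightarrow> (real^2) set"
    and A B V W :: 'v and a b v w :: "real^2"
  assumes "simple_graph Vs E"
    and "convex_compact_visibility_rep Vs E R"
    and "distinct [A, B, V, W]"
    and "is_sightline Vs R A B a b"
    and "is_sightline Vs R V W v w"
    and "closed_segment a b \<inter> closed_segment v w \<noteq> {}"
  shows "\<exists>C\<in>Vs. \<exists>D\<in>Vs. distinct [A, B, C, D] \<and>
           (\<forall>x\<in>{A, B, C, D}. \<forall>y\<in>{A, B, C, D}. x \<noteq> y \<longrightarrow> E x y)"
proof -
  note sl = assms(4,5)
  have reg: "R x \<noteq> {}" "compact (R x)" "convex (R x)" if "x \<in> Vs" for x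
    using assms(2) that
    by (auto simp: convex_compact_visibility_rep_def visibility_rep_def region_family_def)
  have disj: "R x \<inter> R y = {}" if "x \<in> Vs" "y \<in> Vs" "x \<noteq> y" for x y
    using assms(2) that
    by (auto simp: convex_compact_visibility_rep_def visibility_rep_def region_family_def)
  have adj: "E x y \<and> E y x" if "is_sightline Vs R x y p q" for x y p q
  proof -
    have "x \<in> Vs" "y \<in> Vs" "x \<noteq> y" using that by (auto simp: is_sightline_def)
    then have "E x y" using assms(2) that
      unfolding convex_compact_visibility_rep_def visibility_rep_def by blast
    then show ?thesis using assms(1) by (auto simp: simple_graph_def)
  qed
  have V: "A \<in> Vs" "B \<in> Vs" "V \<in> Vs" "W \<in> Vs" using sl by (auto simp: is_sightline_def)
  define Q where "Q = closed_segment v w"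
  define g where "g x = infdist x Q" for x
  define F where "F = (\<Union>z \<in> Vs - {A, B}. R z)"
  define K where "K = R A \<union> R B"
  have F: "compact F" "v \<in> F" "w \<in> F"
    using assms(1,3) V sl reg unfolding F_def simple_graph_def is_sightline_def
    by (auto intro!: compact_UN)
  have K: "compact K" "K \<noteq> {}" using reg V by (auto simp: K_def)
  have KF: "K \<inter> F = {}" using disj V unfolding K_def F_def by blast
  have KQ: "K \<inter> Q = {}" using sl(2) assms(3) V unfolding K_def Q_def is_sightline_def by auto
  have "continuous_on K g" unfolding g_def by (intro continuous_intros)
  then obtain m where m: "m \<in> K" "\<And>x. x \<in> K \<Longrightarrow> g m \<le> g x"
    using continuous_attains_inf[OF K] by blast
  have gm: "0 < g m" unfolding g_def
    using m(1) KQ by (intro infdist_pos_not_in_closed) (auto simp: Q_def)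
  obtain \<rho> where \<rho>: "0 < \<rho>" "\<And>x y. x \<in> K \<Longrightarrow> y \<in> F \<Longrightarrow> \<rho> \<le> dist x y"
    using separate_compact_closed[OF K(1) compact_imp_closed[OF F(1)] KF] by blast
  \<comment> \<open>The summand 1 keeps the divisor \<open>M\<close> positive.\<close>
  define M where "M = diameter (K \<union> Q) + 1"
  have bdd: "bounded (K \<union> Q)" using K(1) by (auto simp: Q_def compact_imp_bounded)
  have M: "0 < M" "\<And>x q. x \<in> K \<Longrightarrow> q \<in> Q \<Longrightarrow> dist x q \<le> M"
    using diameter_ge_0[OF bdd] diameter_bounded_bound[OF bdd] unfolding M_def by (simp, force)
  \<comment> \<open>Chosen so that \<open>\<epsilon> * dist x q \<le> \<epsilon> * M = g m * \<rho>
    \<le> g x * dist x c\<close>, uniformly for ends in \<open>K\<close> and contacts in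
    \<open>F\<close>.\<close>
  define \<epsilon> where "\<epsilon> = g m * \<rho> / M"
  have \<epsilon>0: "0 < \<epsilon>" using gm \<rho> M by (simp add: \<epsilon>_def)
  have \<epsilon>: "\<epsilon> * dist x q \<le> g x * dist x c" if "x \<in> K" "c \<in> F" "q \<in> Q" for x c q
  proof -
    have "\<epsilon> * dist x q \<le> \<epsilon> * M" using \<epsilon>0 M that by (intro mult_left_mono) auto
    also have "\<dots> = g m * \<rho>" using M by (simp add: \<epsilon>_def)
    also have "\<dots> \<le> g x * dist x c" using m(2) \<rho> that gm by (intro mult_mono) (auto intro: order.trans[of 0 "g m"])
    finally show ?thesis .
  qed
  define P where "P = {(x, y). x \<in> R A \<and> y \<in> R B \<and> closed_segment x y \<inter> F = {} \<and> closed_segment x y \<inter> Q \<noteq> {}}"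
  have "(a, b) \<in> P" using sl assms(6) by (auto simp: P_def F_def Q_def is_sightline_def)
  then obtain z where z: "z \<in> P" "\<And>y. y \<in> P \<Longrightarrow> g (fst z) + g (snd z) < (g (fst y) + g (snd y)) + \<epsilon>"
    using near_minimizer[of "(a, b)" P "\<lambda>z. g (fst z) + g (snd z)" \<epsilon>] \<epsilon>0
    by (auto simp: g_def infdist_nonneg)
  obtain a' b' where ab': "z = (a', b')" by (cases z)
  have P: "a' \<in> R A" "b' \<in> R B" "closed_segment a' b' \<inter> F = {}" "closed_segment a' b' \<inter> Q \<noteq> {}"
    using z(1) by (auto simp: P_def ab')
  \<comment> \<open>Keeping the other end fixed cancels its summand, so near-optimality of the sum
    passes to each end separately.\<close>
  have optA: "g a' < g x + \<epsilon>"
    if "x \<in> R A" "closed_segment x b' \<inter> F = {}" "closed_segment x b' \<inter> Q \<noteq> {}" for x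
    using z(2)[of "(x, b')"] that P by (auto simp: P_def ab')
  have optB: "g b' < g x + \<epsilon>"
    if "x \<in> R B" "closed_segment x a' \<inter> F = {}" "closed_segment x a' \<inter> Q \<noteq> {}" for x
    using z(2)[of "(a', x)"] that P by (auto simp: P_def ab' closed_segment_commute)
  have AB: "R A \<inter> Q = {}" "R A \<inter> F = {}" "R B \<inter> Q = {}" "R B \<inter> F = {}" "a' \<in> K" "b' \<in> K"
    using KF KQ P by (auto simp: K_def)
  obtain c d where cd: "c \<in> F" "d \<in> F" "midpoint c d \<notin> F" "closed_segment c d \<inter> F \<subseteq> {c, d}"
      "closed_segment c d \<inter> (R A \<union> R B) = {}"
    and ca: "\<And>e. e \<in> {c, d} \<Longrightarrow> closed_segment e a' \<inter> R B = {} \<and> closed_segment e a' \<inter> F \<subseteq> {e}"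
    and cb: "\<And>e. e \<in> {c, d} \<Longrightarrow> closed_segment e b' \<inter> R A = {} \<and> closed_segment e b' \<inter> F \<subseteq> {e}"
    using crossing_contacts[of "R A" a' v w F "R B" b' \<epsilon>, folded Q_def, folded g_def,
        OF reg(3)[OF V(1)] P(1) AB(1,2) reg(3)[OF V(2)] P(2) AB(3,4) F P(3,4) optA optB \<epsilon>[OF AB(5)] \<epsilon>[OF AB(6)]]
    by blast
  obtain C D where C: "C \<in> Vs" "C \<noteq> A" "C \<noteq> B" "c \<in> R C" and D: "D \<in> Vs" "D \<noteq> A" "D \<noteq> B" "d \<in> R D"
    using cd(1,2) by (auto simp: F_def)
  \<comment> \<open>A common convex region would contain the midpoint of \<open>c\<close> and
    \<open>d\<close>, which is outside \<open>F\<close>.\<close>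
  have "C \<noteq> D"
  proof
    assume "C = D"
    then have "midpoint c d \<in> R C"
      using C D closed_segment_subset[OF _ _ reg(3)[OF C(1)], of c d] by auto
    then show False using cd(3) C by (auto simp: F_def)
  qed
  have FR: "x \<in> F" if "x \<in> R y" "y \<in> Vs" "y \<noteq> A" "y \<noteq> B" for x y
    using that by (auto simp: F_def)
  have uniq: "y = z" if "x \<in> R y" "x \<in> R z" "y \<in> Vs" "z \<in> Vs" for x y z
    using disj that by blast
  \<comment> \<open>The segments meet \<open>F\<close> at most in \<open>e\<close>, so a third
    region met by one of them would contain \<open>e\<close> and hence be \<open>X\<close>
    itself.\<close>
  have eA: "is_sightline Vs R X A e a'" and eB: "is_sightline Vs R X B e b'"
    if "e \<in> {c, d}" "e \<in> R X" "X \<in> Vs" "X \<noteq> A" "X \<noteq> B" for e X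
    unfolding is_sightline_def using that P V ca[OF that(1)] cb[OF that(1)] FR uniq by blast+
  have CD: "is_sightline Vs R C D c d"
    unfolding is_sightline_def using C D \<open>C \<noteq> D\<close> cd FR uniq by blast
  have E: "E A B \<and> E B A" "E C A \<and> E A C" "E C B \<and> E B C" "E D A \<and> E A D" "E D B \<and> E B D" "E C D \<and> E D C"
    using adj[OF sl(1)] adj[OF eA] adj[OF eB] adj[OF CD] C D by blast+
  show ?thesis
  proof (intro bexI)
    show "distinct [A, B, C, D] \<and> (\<forall>x\<in>{A, B, C, D}. \<forall>y\<in>{A, B, C, D}. x \<noteq> y \<longrightarrow> E x y)"
      using E C D \<open>C \<noteq> D\<close> assms(3) by auto
  qed (use C D in auto)
qed

end
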